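(* Let $P$ be a fence poset. Then the order polynomial $\Omega(P;t)$ has nonnegative coefficients.
   Context: A skew shape $\lambda/\mu$ is given by partitions $\lambda=(\lambda_1\ge\cdots\ge\lambda_\ell\ge 0)$ and $\mu=(\mu_1\ge\cdots\ge\mu_\ell\ge 0)$ with $\mu_i\le\lambda_i$ for all $i$. The cell poset $P_{\lambda/\mu}$ has as elements the boxes $\{(i,j): 1\le i\le \ell,\ \mu_i+1\le j\le\lambda_i\}$, with partial order generated by $(i,j)\succeq(i+1,j)$ and $(i,j)\succeq(i,j+1)$ (whenever both boxes belong to the shape). The skew shape is a ribbon (border strip) if its Young diagram contains no $2\times 2$ square, and a fence poset is a poset isomorphic to the cell poset $P_{\lambda/\mu}$ of a ribbon $\lambda/\mu$. For a finite poset $P$, the order polynomial $\Omega(P;t)$ is the unique polynomial in $\mathbb{Q}[t]$ such that for every positive integer $t$, $\Omega(P;t)$ equals the number of maps $f:P\to\{1,\dots,t\}$ with $f(x)\le f(y)$ whenever $x\preceq y$. *)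

theory Defs
  imports
    Complex_Main
    "HOL-Library.FuncSet"
    "HOL-Computational_Algebra.Polynomial"
begin

text \<open>
  A poset is a carrier \<open>P\<close> with a relation \<open>r\<close> satisfying \<open>partial_order_on P r\<close>;
  \<open>(x, y) \<in> r\<close> means that \<open>x\<close> is below or equal to \<open>y\<close>.

  Two partitions of common length \<open>l\<close> are lists \<open>la\<close> and \<open>mu\<close>, in which trailing zeros are
  allowed. Boxes are numbered from 1, so the row \<open>i\<close> of a shape is read off at list index \<open>i - 1\<close>.
\<close>

definition skew_shape :: "nat list \<Rightarrow> nat list \<Rightarrow> bool" where
  "skew_shape la mu \<longleftrightarrow>
     length mu = length la \<and> sorted_wrt (\<ge>) la \<and> sorted_wrt (\<ge>) mu \<and>
     (\<forall>i<length la. mu ! i \<le> la ! i)"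

definition boxes :: "nat list \<Rightarrow> nat list \<Rightarrow> (nat \<times> nat) set" where
  "boxes la mu =
     {(i, j). 1 \<le> i \<and> i \<le> length la \<and> mu ! (i - 1) + 1 \<le> j \<and> j \<le> la ! (i - 1)}"

text \<open>The generating relations point upwards: the lower box is the first component.\<close>

definition box_step :: "nat list \<Rightarrow> nat list \<Rightarrow> (nat \<times> nat) rel" where
  "box_step la mu =
     {((i + 1, j), (i, j)) | i j. (i, j) \<in> boxes la mu \<and> (i + 1, j) \<in> boxes la mu} \<union>
     {((i, j + 1), (i, j)) | i j. (i, j) \<in> boxes la mu \<and> (i, j + 1) \<in> boxes la mu}"

definition cell_order :: "nat list \<Rightarrow> nat list \<Rightarrow> (nat \<times> nat) rel" where
  "cell_order la mu = Restr ((box_step la mu)\<^sup>*) (boxes la mu)"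

text \<open>Connectedness is not part of the notion of a ribbon used here.\<close>

definition ribbon :: "nat list \<Rightarrow> nat list \<Rightarrow> bool" where
  "ribbon la mu \<longleftrightarrow>
     skew_shape la mu \<and>
     \<not> (\<exists>i j. {(i, j), (i + 1, j), (i, j + 1), (i + 1, j + 1)} \<subseteq> boxes la mu)"

definition poset_isomorphic :: "'a set \<Rightarrow> 'a rel \<Rightarrow> 'b set \<Rightarrow> 'b rel \<Rightarrow> bool" where
  "poset_isomorphic P r Q s \<longleftrightarrow>
     (\<exists>f. bij_betw f P Q \<and> (\<forall>x\<in>P. \<forall>y\<in>P. (x, y) \<in> r \<longleftrightarrow> (f x, f y) \<in> s))"

definition fence_poset :: "'a set \<Rightarrow> 'a rel \<Rightarrow> bool" where
  "fence_poset P r \<longleftrightarrow>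
     partial_order_on P r \<and>
     (\<exists>la mu. ribbon la mu \<and> poset_isomorphic P r (boxes la mu) (cell_order la mu))"

text \<open>The maps are extensional on \<open>P\<close>, so that each map on \<open>P\<close> is counted exactly once.\<close>

definition order_preserving_maps :: "'a set \<Rightarrow> 'a rel \<Rightarrow> nat \<Rightarrow> ('a \<Rightarrow> nat) set" where
  "order_preserving_maps P r t =
     {f \<in> P \<rightarrow>\<^sub>E {1..t}. monotone_on P (\<lambda>x y. (x, y) \<in> r) (\<le>) f}"

definition order_polynomial :: "'a set \<Rightarrow> 'a rel \<Rightarrow> rat poly" where
  "order_polynomial P r =
     (THE p. \<forall>t\<ge>1. poly p (of_nat t) = of_nat (card (order_preserving_maps P r t)))"

end

theory Submission
  imports Defs
begin

text \<open>
  Write \<open>\<Omega>(P; t)\<close> for the order polynomial. Cutting a map into \<open>{1..s+t}\<close> at height \<open>s\<close>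
  splits \<open>P\<close> into a down-set \<open>I\<close> and its complement, so that
  \<open>\<Omega>(P; s + t) = (\<Sum>I. \<Omega>(I; s) \<cdot> \<Omega>(P - I; t))\<close>. Comparing the coefficients of \<open>s\<close> gives
  \<open>\<Omega>'(P; t) = (\<Sum>I. \<omega>(I) \<cdot> \<Omega>(P - I; t))\<close>, where \<open>\<omega>(I)\<close> is the linear coefficient of
  \<open>\<Omega>(I; t)\<close>. By induction on \<open>P\<close>, all coefficients of \<open>\<Omega>(P; t)\<close> are nonnegative as soon as
  the linear coefficients of all subposets of \<open>P\<close> are
  (\<open>nonneg_coeffs_if_linear_coeffs_nonneg\<close>).

  In a ribbon the content \<open>j - i\<close> separates the boxes, and two boxes are adjacent exactly when
  their contents differ by 1. A fence is therefore a finite set \<open>Q\<close> of natural numbers in which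
  any two consecutive members are related, in a direction of their own, and a subset of a fence
  is again of this kind.

  The linear coefficient of such a \<open>Q\<close> is found by inclusion and exclusion
  (\<open>linear_coeff_path\<close>): a condition \<open>f k \<ge> f (k + 1)\<close> is the absence of a condition minus
  \<open>f k < f (k + 1)\<close>. Without a condition the count becomes a product of two counts that vanish at
  \<open>t = 0\<close>, which has no linear term; the same happens at a gap of \<open>Q\<close>. Without gaps, each replacement of \<open>\<ge>\<close> by \<open><\<close> just
  changes the sign of the linear coefficient. Eventually the conditions form a single chain of \<open>n\<close>
  numbers with \<open>m\<close> relations \<open>\<le>\<close> and \<open>d = n - 1 - m\<close> relations \<open><\<close>,
  counted by the binomial coefficient of \<open>t + m\<close> over \<open>n\<close>, whose linear coefficient
  \<open>(-1)^d \<cdot> m! \<cdot> d! / n!\<close> has the sign \<open>(-1)^d\<close>. If all strict relations stem from relations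
  \<open>\<ge>\<close>, these signs cancel.
\<close>

section \<open>Polynomials that count\<close>

text \<open>The value at \<open>t = 0\<close> is included: it gives the constant coefficient.\<close>

definition interpolates :: "rat poly \<Rightarrow> (nat \<Rightarrow> nat) \<Rightarrow> bool" where
  "interpolates p c \<longleftrightarrow> (\<forall>t. poly p (of_nat t) = of_nat (c t))"

lemma poly_eqI_of_nat:
  fixes p q :: "rat poly"
  assumes "\<And>t. t \<ge> m \<Longrightarrow> poly p (of_nat t) = poly q (of_nat t)"
  shows "p = q"
proof (rule poly_eqI_degree)
  show "poly p x = poly q x" if "x \<in> of_nat ` {m..m + max (degree p) (degree q)}" for x
    using that assms by auto
  have "card (of_nat ` {m..m + max (degree p) (degree q)} :: rat set)
      = Suc (max (degree p) (degree q))"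
    by (subst card_image) (auto simp: inj_on_def)
  then show "degree p < card (of_nat ` {m..m + max (degree p) (degree q)} :: rat set)"
    "degree q < card (of_nat ` {m..m + max (degree p) (degree q)} :: rat set)"
    by auto
qed

lemma order_polynomial_eqI:
  assumes "interpolates p (\<lambda>t. card (order_preserving_maps P r t))"
  shows "order_polynomial P r = p"
  unfolding order_polynomial_def
proof (rule the_equality)
  show "\<forall>t\<ge>1. poly p (of_nat t) = of_nat (card (order_preserving_maps P r t))"
    using assms by (auto simp: interpolates_def)
next
  fix q :: "rat poly"
  assume "\<forall>t\<ge>1. poly q (of_nat t) = of_nat (card (order_preserving_maps P r t))"
  then show "q = p"
    using assms by (intro poly_eqI_of_nat[of 1]) (auto simp: interpolates_def)
qed

section \<open>From linear coefficients to all coefficients\<close>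

lemma finite_order_preserving_maps:
  "finite P \<Longrightarrow> finite (order_preserving_maps P r t)"
  unfolding order_preserving_maps_def by (rule finite_subset[OF _ finite_PiE[of P "\<lambda>_. {1..t}"]]) auto

lemma order_preserving_maps_iff:
  "f \<in> order_preserving_maps P r t \<longleftrightarrow>
     f \<in> extensional P \<and> (\<forall>x\<in>P. 1 \<le> f x \<and> f x \<le> t) \<and>
     (\<forall>x\<in>P. \<forall>y\<in>P. (x, y) \<in> r \<longrightarrow> f x \<le> f y)"
  unfolding order_preserving_maps_def monotone_on_def by (auto simp: PiE_iff)

definition down_sets :: "'a set \<Rightarrow> 'a rel \<Rightarrow> 'a set set" where
  "down_sets P r = {I. I \<subseteq> P \<and> (\<forall>y\<in>I. \<forall>x\<in>P. (x, y) \<in> r \<longrightarrow> x \<in> I)}"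

text \<open>
  A map into \<open>{1..s + t}\<close> is the same as the down-set \<open>I\<close> where its values are at most \<open>s\<close>,
  its restriction to \<open>I\<close>, and its values minus \<open>s\<close> on the complement. The relation may be
  arbitrary, so subsets need no order of their own.
\<close>

lemma card_order_preserving_maps_add:
  assumes "finite P"
  shows "card (order_preserving_maps P r (s + t)) =
    (\<Sum>I\<in>down_sets P r. card (order_preserving_maps I r s) * card (order_preserving_maps (P - I) r t))"
proof -
  let ?S = "SIGMA I:down_sets P r. order_preserving_maps I r s \<times> order_preserving_maps (P - I) r t"
  define F where "F f = ({x \<in> P. f x \<le> s}, restrict f {x \<in> P. f x \<le> s},
    restrict (\<lambda>x. f x - s) (P - {x \<in> P. f x \<le> s}))" for f :: "'a \<Rightarrow> nat"
  define G where "G = (\<lambda>(I, g, h :: 'a \<Rightarrow> nat). restrict (\<lambda>x. if x \<in> I then g x else s + h x) P)"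
  have "bij_betw F (order_preserving_maps P r (s + t)) ?S"
  proof (rule bij_betw_byWitness[where f' = G])
    show "\<forall>f\<in>order_preserving_maps P r (s + t). G (F f) = f"
      by (auto simp: order_preserving_maps_iff F_def G_def extensional_def fun_eq_iff)
    show "\<forall>z\<in>?S. F (G z) = z"
    proof (clarify)
      fix I g h
      assume I: "I \<in> down_sets P r" and g: "g \<in> order_preserving_maps I r s"
        and h: "h \<in> order_preserving_maps (P - I) r t"
      have "I \<subseteq> P" using I by (simp add: down_sets_def)
      moreover have "g x \<le> s" if "x \<in> I" for x
        using g that by (simp add: order_preserving_maps_iff)
      moreover have "1 \<le> h x" if "x \<in> P" "x \<notin> I" for x
        using h that by (simp add: order_preserving_maps_iff)
      ultimately have "{x \<in> P. G (I, g, h) x \<le> s} = I"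
        by (force simp: G_def)
      then show "F (G (I, g, h)) = (I, g, h)"
        using \<open>I \<subseteq> P\<close> g h unfolding F_def
        by (auto simp: G_def order_preserving_maps_iff extensional_def fun_eq_iff)
    qed
    show "F ` order_preserving_maps P r (s + t) \<subseteq> ?S"
    proof (rule image_subsetI)
      fix f assume f: "f \<in> order_preserving_maps P r (s + t)"
      then have "{x \<in> P. f x \<le> s} \<in> down_sets P r"
        by (auto simp: order_preserving_maps_iff down_sets_def intro: order_trans)
      with f show "F f \<in> ?S"
        by (auto simp: order_preserving_maps_iff F_def diff_le_mono)
    qed
    show "G ` ?S \<subseteq> order_preserving_maps P r (s + t)"
    proof (clarify)
      fix I g h
      assume I: "I \<in> down_sets P r" and g: "g \<in> order_preserving_maps I r s"
        and h: "h \<in> order_preserving_maps (P - I) r t"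
      have "g x \<le> s + m" if "x \<in> I" for x m
        using g that by (simp add: order_preserving_maps_iff trans_le_add1)
      moreover have "x \<in> I" if "(x, y) \<in> r" "x \<in> P" "y \<in> I" for x y
        using I that by (auto simp: down_sets_def)
      moreover have "1 \<le> g x" "g x \<le> s + t" if "x \<in> I" for x
        using g that by (simp_all add: order_preserving_maps_iff trans_le_add1)
      moreover have "h x \<le> t" if "x \<in> P" "x \<notin> I" for x
        using h that by (simp add: order_preserving_maps_iff)
      moreover have "1 \<le> s + h x" if "x \<in> P" "x \<notin> I" for x
        using h that by (simp add: order_preserving_maps_iff trans_le_add2)
      moreover have "g x \<le> g y" if "(x, y) \<in> r" "x \<in> I" "y \<in> I" for x y
        using g that by (simp add: order_preserving_maps_iff)
      moreover have "h x \<le> h y" if "(x, y) \<in> r" "x \<in> P - I" "y \<in> P - I" for x y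
        using h that by (simp add: order_preserving_maps_iff)
      ultimately show "G (I, g, h) \<in> order_preserving_maps P r (s + t)"
        unfolding order_preserving_maps_iff G_def
        by (simp add: Ball_def) blast
    qed
  qed
  then have "card (order_preserving_maps P r (s + t)) = card ?S"
    by (rule bij_betw_same_card)
  also have "\<dots> = (\<Sum>I\<in>down_sets P r. card (order_preserving_maps I r s \<times> order_preserving_maps (P - I) r t))"
  proof (intro card_SigmaI ballI finite_cartesian_product)
    show "finite (down_sets P r)"
      using assms by (auto intro!: finite_subset[of "down_sets P r" "Pow P"] simp: down_sets_def)
    show "finite (order_preserving_maps I r s)" if "I \<in> down_sets P r" for I
      using that assms finite_subset[of I P]
      by (simp add: down_sets_def finite_order_preserving_maps)
  qed (use assms in \<open>simp add: finite_order_preserving_maps\<close>)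
  finally show ?thesis by (simp add: card_cartesian_product)
qed

lemma coeff_1_eq_pderiv: "coeff (p :: rat poly) 1 = poly (pderiv p) 0"
  by (simp add: poly_0_coeff_0 coeff_pderiv)

text \<open>
  The derivative of the convolution identity in \<open>s\<close> at \<open>s = 0\<close> expresses the derivative of
  \<open>W P\<close> through the \<open>W (P - I)\<close> with weights \<open>coeff (W I) 1\<close>. The term \<open>I = {}\<close>, which alone
  would refer back to \<open>P\<close>, has weight 0.
\<close>

lemma nonneg_coeffs_if_linear_coeffs_nonneg:
  fixes W :: "'a set \<Rightarrow> rat poly"
  assumes "finite P"
    and "\<And>Q. Q \<subseteq> P \<Longrightarrow> interpolates (W Q) (\<lambda>t. card (order_preserving_maps Q r t))"
    and "\<And>Q. Q \<subseteq> P \<Longrightarrow> 0 \<le> coeff (W Q) 1"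
  shows "0 \<le> coeff (W P) n"
  using assms
proof (induction P arbitrary: n rule: finite_psubset_induct)
  case (psubset P)
  have val: "poly (W Q) (of_nat t) = of_nat (card (order_preserving_maps Q r t))" if "Q \<subseteq> P" for Q t
    using psubset.prems(1)[OF that] by (simp add: interpolates_def)
  have sub: "I \<subseteq> P" if "I \<in> down_sets P r" for I
    using that by (auto simp: down_sets_def)
  have deriv: "pderiv (W P) = (\<Sum>I\<in>down_sets P r. smult (coeff (W I) 1) (W (P - I)))"
  proof (rule poly_eqI_of_nat[of 0])
    fix t :: nat
    let ?T = "[:of_nat t, 1:] :: rat poly"
    \<comment> \<open>The convolution identity as an identity of polynomials in \<open>s\<close>, for a fixed number \<open>t\<close>.\<close>
    have shift: "pcompose (W P) ?T =
        (\<Sum>I\<in>down_sets P r. smult (of_nat (card (order_preserving_maps (P - I) r t))) (W I))"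
    proof (rule poly_eqI_of_nat[of 0])
      fix s :: nat
      have "poly (pcompose (W P) ?T) (of_nat s) = poly (W P) (of_nat (s + t))"
        by (simp add: poly_pcompose add.commute)
      also have "\<dots> = of_nat (\<Sum>I\<in>down_sets P r.
          card (order_preserving_maps I r s) * card (order_preserving_maps (P - I) r t))"
        by (simp only: val[OF subset_refl] card_order_preserving_maps_add[OF psubset.hyps])
      also have "\<dots> = poly (\<Sum>I\<in>down_sets P r.
          smult (of_nat (card (order_preserving_maps (P - I) r t))) (W I)) (of_nat s)"
        by (auto simp: poly_sum val sub mult.commute intro!: sum.cong)
      finally show "poly (pcompose (W P) ?T) (of_nat s) = \<dots>" .
    qed
    have "poly (pderiv (W P)) (of_nat t) = coeff (pcompose (W P) ?T) 1"
      unfolding coeff_1_eq_pderiv by (simp add: pderiv_pcompose poly_pcompose pderiv_pCons)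
    also have "\<dots> = poly (\<Sum>I\<in>down_sets P r. smult (coeff (W I) 1) (W (P - I))) (of_nat t)"
      unfolding shift by (auto simp: coeff_sum poly_sum val intro!: sum.cong)
    finally show "poly (pderiv (W P)) (of_nat t) = \<dots>" .
  qed
  have "W {} = 1"
  proof (rule poly_eqI_of_nat[of 0])
    have "order_preserving_maps {} r t = {\<lambda>x. undefined}" for t
      by (auto simp: order_preserving_maps_iff)
    then show "poly (W {}) (of_nat t) = poly 1 (of_nat t)" for t
      by (simp add: val)
  qed
  have "0 \<le> coeff (smult (coeff (W I) 1) (W (P - I))) k" if "I \<in> down_sets P r" for I k
  proof (cases "I = {}")
    case True
    then show ?thesis using \<open>W {} = 1\<close> by simp
  next
    case False
    have "0 \<le> coeff (W (P - I)) k"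
    proof (rule psubset.IH)
      show "P - I \<subset> P" using False sub[OF that] by auto
    qed (use psubset.prems in auto)
    then show ?thesis
      using psubset.prems(2)[OF sub[OF that]] by simp
  qed
  then have "0 \<le> coeff (pderiv (W P)) k" for k
    unfolding deriv coeff_sum by (intro sum_nonneg)
  then have "0 \<le> coeff (W P) (Suc k)" for k
    using mult_le_cancel_left_pos[of "of_nat (Suc k)" 0 "coeff (W P) (Suc k)"]
    by (simp only: coeff_pderiv of_nat_0_less_iff zero_less_Suc mult_zero_right simp_thms)
  moreover have "0 \<le> coeff (W P) 0"
    using val[of P 0] by (simp add: poly_0_coeff_0)
  ultimately show ?case by (cases n) auto
qed

section \<open>Maps on paths with weak and strict steps\<close>

text \<open>
  The kind of a link is the condition put on the values at \<open>i\<close> and \<open>i + 1\<close>. \<open>Free\<close> and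
  \<open>Strict_Up\<close> do not occur in a fence; they are the two outcomes of resolving a
  \<open>Weak_Down\<close>.
\<close>

datatype link = Free | Weak_Up | Strict_Up | Weak_Down

fun fits :: "link \<Rightarrow> nat \<Rightarrow> nat \<Rightarrow> bool" where
  "fits Free a b \<longleftrightarrow> True"
| "fits Weak_Up a b \<longleftrightarrow> a \<le> b"
| "fits Strict_Up a b \<longleftrightarrow> a < b"
| "fits Weak_Down a b \<longleftrightarrow> b \<le> a"

definition path_maps :: "(nat \<Rightarrow> link) \<Rightarrow> nat set \<Rightarrow> nat \<Rightarrow> (nat \<Rightarrow> nat) set" where
  "path_maps \<rho> P t =
     {f \<in> P \<rightarrow>\<^sub>E {1..t}. \<forall>i. i \<in> P \<and> Suc i \<in> P \<longrightarrow> fits (\<rho> i) (f i) (f (Suc i))}"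

definition links :: "(nat \<Rightarrow> link) \<Rightarrow> link \<Rightarrow> nat set \<Rightarrow> nat set" where
  "links \<rho> l P = {i \<in> P. Suc i \<in> P \<and> \<rho> i = l}"

lemma finite_links: "finite P \<Longrightarrow> finite (links \<rho> l P)"
  by (simp add: links_def)

lemma finite_path_maps: "finite P \<Longrightarrow> finite (path_maps \<rho> P t)"
  unfolding path_maps_def by (rule finite_subset[OF _ finite_PiE[of P "\<lambda>_. {1..t}"]]) auto

text \<open>
  There is no condition across a cut behind \<open>k\<close> if the link at \<open>k\<close> is \<open>Free\<close> or if one of
  its ends is missing from \<open>P\<close>; the lemma covers both ways in which a path falls apart.
\<close>

lemma card_path_maps_split:
  assumes free: "k \<in> P \<Longrightarrow> Suc k \<in> P \<Longrightarrow> \<rho> k = Free"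
  shows "card (path_maps \<rho> P t) =
    card (path_maps \<rho> (P \<inter> {..k}) t) * card (path_maps \<rho> (P \<inter> {k<..}) t)"
proof -
  let ?A = "P \<inter> {..k}" and ?B = "P \<inter> {k<..}"
  let ?F = "\<lambda>f. (restrict f ?A, restrict f ?B)"
  define G where "G = (\<lambda>(g, h :: nat \<Rightarrow> nat). restrict (\<lambda>x. if x \<le> k then g x else h x) P)"
  have "bij_betw ?F (path_maps \<rho> P t) (path_maps \<rho> ?A t \<times> path_maps \<rho> ?B t)"
  proof (rule bij_betw_byWitness[where f' = G])
    show "\<forall>f\<in>path_maps \<rho> P t. G (?F f) = f"
      "\<forall>z\<in>path_maps \<rho> ?A t \<times> path_maps \<rho> ?B t. ?F (G z) = z"
      by (auto simp: G_def path_maps_def PiE_iff extensional_def fun_eq_iff)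
    show "?F ` path_maps \<rho> P t \<subseteq> path_maps \<rho> ?A t \<times> path_maps \<rho> ?B t"
      by (auto simp: path_maps_def PiE_iff)
    show "G ` (path_maps \<rho> ?A t \<times> path_maps \<rho> ?B t) \<subseteq> path_maps \<rho> P t"
    proof clarify
      fix g h assume g: "g \<in> path_maps \<rho> ?A t" and h: "h \<in> path_maps \<rho> ?B t"
      have "fits (\<rho> i) (G (g, h) i) (G (g, h) (Suc i))" if "i \<in> P" "Suc i \<in> P" for i
        using g h that free by (cases i k rule: linorder_cases) (auto simp: G_def path_maps_def)
      then show "G (g, h) \<in> path_maps \<rho> P t"
        using g h by (auto simp: path_maps_def PiE_iff G_def)
    qed
  qed
  then show ?thesis by (simp add: bij_betw_same_card card_cartesian_product)
qed

lemma card_path_maps_weak_down: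
  assumes "finite P" "k \<in> P" "Suc k \<in> P" "\<rho> k = Weak_Down"
  shows "card (path_maps (\<rho>(k := Free)) P t) =
    card (path_maps \<rho> P t) + card (path_maps (\<rho>(k := Strict_Up)) P t)"
proof -
  have "path_maps (\<rho>(k := Free)) P t = path_maps \<rho> P t \<union> path_maps (\<rho>(k := Strict_Up)) P t"
  proof (intro set_eqI iffI)
    fix f assume f: "f \<in> path_maps (\<rho>(k := Free)) P t"
    then have others: "fits (\<rho> i) (f i) (f (Suc i))" if "i \<in> P" "Suc i \<in> P" "i \<noteq> k" for i
      using that by (auto simp: path_maps_def)
    show "f \<in> path_maps \<rho> P t \<union> path_maps (\<rho>(k := Strict_Up)) P t"
    proof (cases "f k < f (Suc k)")
      case True
      then have "fits ((\<rho>(k := Strict_Up)) i) (f i) (f (Suc i))" if "i \<in> P" "Suc i \<in> P" for i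
        using others[of i] that by (cases "i = k") simp_all
      then show ?thesis using f by (simp add: path_maps_def)
    next
      case False
      then have "fits (\<rho> i) (f i) (f (Suc i))" if "i \<in> P" "Suc i \<in> P" for i
        using others[of i] that assms by (cases "i = k") simp_all
      then show ?thesis using f by (simp add: path_maps_def)
    qed
  next
    fix f assume f: "f \<in> path_maps \<rho> P t \<union> path_maps (\<rho>(k := Strict_Up)) P t"
    then show "f \<in> path_maps (\<rho>(k := Free)) P t"
      by (auto simp: path_maps_def split: if_splits)
  qed
  moreover have "path_maps \<rho> P t \<inter> path_maps (\<rho>(k := Strict_Up)) P t = {}"
  proof -
    have "fits (\<sigma> k) (f k) (f (Suc k))" if "f \<in> path_maps \<sigma> P t" for f \<sigma>
      using that assms by (simp add: path_maps_def)
    from this[of _ \<rho>] this[of _ "\<rho>(k := Strict_Up)"] show ?thesis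
      using assms by fastforce
  qed
  ultimately show ?thesis
    using assms by (simp add: card_Un_disjoint finite_path_maps)
qed

lemma path_maps_up_le:
  assumes up: "\<And>i. a \<le> i \<Longrightarrow> i < k \<Longrightarrow> \<rho> i \<in> {Weak_Up, Strict_Up}"
    and f: "f \<in> path_maps \<rho> {a..k} t" and "a \<le> x" "x \<le> k"
  shows "f x \<le> f k"
  using \<open>x \<le> k\<close>
proof (induction rule: inc_induct)
  case (step n)
  have "fits (\<rho> n) (f n) (f (Suc n))"
    using f step.hyps \<open>a \<le> x\<close> by (simp add: path_maps_def)
  then have "f n \<le> f (Suc n)"
    using up[of n] step.hyps \<open>a \<le> x\<close> by auto
  then show ?case using step by simp
qed simp

text \<open>
  Pascal's recurrence: either the last value, which is the largest one, is at most \<open>t\<close>, or it is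
  \<open>Suc t\<close> and can be removed. In the latter case the preceding values are bounded by
  \<open>Suc t\<close> or by \<open>t\<close> according to the kind of the last link.
\<close>

lemma path_maps_up_Suc:
  assumes up: "\<And>i. a \<le> i \<Longrightarrow> i < Suc k \<Longrightarrow> \<rho> i \<in> {Weak_Up, Strict_Up}" and "a \<le> k"
  shows "card (path_maps \<rho> {a..Suc k} (Suc t)) =
    card (path_maps \<rho> {a..Suc k} t) + card (path_maps \<rho> {a..k} (if \<rho> k = Weak_Up then Suc t else t))"
proof -
  let ?top = "\<lambda>g. g(Suc k := Suc t)"
  let ?M = "path_maps \<rho> {a..k} (if \<rho> k = Weak_Up then Suc t else t)"
  have eq: "path_maps \<rho> {a..Suc k} (Suc t) = path_maps \<rho> {a..Suc k} t \<union> ?top ` ?M" (is "?L = ?R")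
  proof (intro set_eqI iffI)
    fix f assume f: "f \<in> ?L"
    then have fS: "f (Suc k) \<le> Suc t" using \<open>a \<le> k\<close> by (auto simp: path_maps_def PiE_iff)
    show "f \<in> ?R"
    proof (cases "f (Suc k) \<le> t")
      case True
      then have "f x \<le> t" if "a \<le> x" "x \<le> Suc k" for x
        using path_maps_up_le[OF up f that] by simp
      then show ?thesis using f by (auto simp: path_maps_def PiE_iff)
    next
      case False
      let ?g = "f(Suc k := undefined)"
      have g: "?g \<in> path_maps \<rho> {a..k} (Suc t)"
        using f by (auto simp: path_maps_def PiE_iff extensional_def)
      have "?g \<in> ?M"
      proof (cases "\<rho> k = Weak_Up")
        case False
        then have "\<rho> k = Strict_Up" using up[of k] \<open>a \<le> k\<close> by auto
        then have "f k < f (Suc k)" using f \<open>a \<le> k\<close> by (auto simp: path_maps_def)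
        then have "f x \<le> t" if "a \<le> x" "x \<le> k" for x
          using path_maps_up_le[OF up g that] fS that by simp
        then show ?thesis using g False by (auto simp: path_maps_def PiE_iff)
      qed (use g in simp)
      moreover have "f = ?top ?g" using False fS by (auto simp: fun_eq_iff)
      ultimately show ?thesis by blast
    qed
  next
    fix f assume "f \<in> ?R"
    then show "f \<in> ?L"
    proof
      assume "f \<in> path_maps \<rho> {a..Suc k} t"
      then show ?thesis by (auto simp: path_maps_def PiE_iff le_SucI)
    next
      assume "f \<in> ?top ` ?M"
      then obtain g where g: "f = ?top g" "g \<in> ?M" by blast
      have "g k \<le> (if \<rho> k = Weak_Up then Suc t else t)"
        using g(2) \<open>a \<le> k\<close> by (auto simp: path_maps_def PiE_iff)
      then have "fits (\<rho> k) (g k) (Suc t)"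
        using up[of k] \<open>a \<le> k\<close> by (auto split: if_splits)
      moreover have "g x \<le> Suc t" if "a \<le> x" "x \<le> k" for x
        using g(2) that by (cases "\<rho> k = Weak_Up") (auto simp: path_maps_def PiE_iff le_SucI)
      moreover have "1 \<le> g x" if "a \<le> x" "x \<le> k" for x
        using g(2) that by (simp add: path_maps_def PiE_iff)
      moreover have "fits (\<rho> x) (g x) (g (Suc x))" if "a \<le> x" "Suc x \<le> k" for x
        using g(2) that by (simp add: path_maps_def)
      moreover have "g \<in> extensional {a..k}"
        using g(2) by (simp add: path_maps_def PiE_iff)
      ultimately show ?thesis
        using \<open>a \<le> k\<close> unfolding g(1)
        by (simp add: path_maps_def PiE_iff extensional_def le_Suc_eq) auto
    qed
  qed
  have "inj_on ?top ?M"
  proof (rule inj_onI)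
    fix g h assume "g \<in> ?M" "h \<in> ?M" and gh: "?top g = ?top h"
    then have "g (Suc k) = h (Suc k)"
      by (auto simp: path_maps_def PiE_iff extensional_def)
    then show "g = h"
      using gh by (metis fun_upd_triv fun_upd_upd)
  qed
  moreover have "path_maps \<rho> {a..Suc k} t \<inter> ?top ` ?M = {}"
  proof -
    have "f (Suc k) \<le> t" if "f \<in> path_maps \<rho> {a..Suc k} t" for f
      using that \<open>a \<le> k\<close> by (simp add: path_maps_def PiE_iff)
    then show ?thesis by fastforce
  qed
  ultimately show ?thesis
    unfolding eq by (simp add: card_Un_disjoint card_image finite_path_maps)
qed

lemma card_path_maps_up:
  assumes "\<And>i. a \<le> i \<Longrightarrow> i < a + n \<Longrightarrow> \<rho> i \<in> {Weak_Up, Strict_Up}"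
  shows "card (path_maps \<rho> {a..a + n} t) =
    (t + card (links \<rho> Weak_Up {a..a + n})) choose Suc n"
  using assms
proof (induction n arbitrary: t)
  case 0
  have "bij_betw (\<lambda>v. (\<lambda>x\<in>{a}. v)) {1..t} (path_maps \<rho> {a} t)"
    by (rule bij_betw_byWitness[where f' = "\<lambda>f. f a"])
       (auto simp: path_maps_def PiE_iff extensional_def fun_eq_iff)
  moreover have "links \<rho> Weak_Up {a} = {}" by (auto simp: links_def)
  ultimately show ?case by (simp add: bij_betw_same_card[symmetric])
next
  case (Suc n)
  let ?m = "card (links \<rho> Weak_Up {a..a + n})"
  have IH: "card (path_maps \<rho> {a..a + n} t) = (t + ?m) choose Suc n" for t
    using Suc by simp
  have up: "\<rho> i \<in> {Weak_Up, Strict_Up}" if "a \<le> i" "i < Suc (a + n)" for i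
    using Suc.prems that by simp
  have m': "card (links \<rho> Weak_Up {a..Suc (a + n)}) = ?m + (if \<rho> (a + n) = Weak_Up then 1 else 0)"
  proof -
    have "links \<rho> Weak_Up {a..Suc (a + n)} =
        links \<rho> Weak_Up {a..a + n} \<union> (if \<rho> (a + n) = Weak_Up then {a + n} else {})"
      by (auto simp: links_def le_Suc_eq)
    moreover have "a + n \<notin> links \<rho> Weak_Up {a..a + n}" by (simp add: links_def)
    ultimately show ?thesis by (simp add: finite_links)
  qed
  have "?m \<le> card {a..<a + n}"
    by (rule card_mono) (auto simp: links_def)
  then have m: "?m \<le> n" by simp
  show ?case
  proof (induction t)
    case 0
    have "path_maps \<rho> {a..a + Suc n} 0 = {}" by (auto simp: path_maps_def PiE_iff)
    then show ?case using m m' by (simp add: binomial_eq_0)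
  next
    case (Suc t)
    then show ?case
      using path_maps_up_Suc[of a "a + n" \<rho> t, OF up] m' by (auto simp: IH)
  qed
qed

section \<open>The linear coefficient of a path\<close>

text \<open>
  Up to the factor \<open>1 / (n + 1)!\<close>, the binomial coefficient is the product of the
  \<open>t + (m - j)\<close> over \<open>j \<le> n\<close>. The factor \<open>j = m\<close> is \<open>t\<close> itself, so the linear coefficient is
  the product of the other \<open>m - j\<close>, of which those with \<open>m < j \<le> n\<close> are negative.
\<close>

lemma interpolates_binomial:
  assumes "m \<le> n"
  shows "\<exists>p. interpolates p (\<lambda>t. (t + m) choose Suc n) \<and> 0 \<le> (-1) ^ (n - m) * coeff p 1"
proof -
  let ?l = "\<lambda>j. [:of_nat m - of_nat j, 1:] :: rat poly"
  define q where "q = (\<Prod>j\<in>{..n} - {m}. ?l j)"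
  define p where "p = smult (inverse (fact (Suc n))) ([:0, 1:] * q)"
  have p: "p = smult (inverse (fact (Suc n))) (\<Prod>j\<le>n. ?l j)"
    using assms unfolding p_def q_def by (subst prod.remove[of "{..n}" m]) auto
  have "poly p (of_nat t) = of_nat ((t + m) choose Suc n)" for t
    unfolding p by (simp add: binomial_gbinomial gbinomial_prod_rev poly_prod divide_inverse
        lessThan_Suc_atMost atLeast0AtMost atLeast0LessThan algebra_simps)
  then have interp: "interpolates p (\<lambda>t. (t + m) choose Suc n)"
    by (simp add: interpolates_def)
  have lin: "coeff p 1 = inverse (fact (Suc n)) * poly q 0"
    unfolding p_def by (simp add: coeff_pCons poly_0_coeff_0)
  have "(-1) ^ (n - m) * poly q 0 = (\<Prod>j<m. of_nat m - of_nat j) * (\<Prod>j\<in>{m<..n}. of_nat j - of_nat m)"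
  proof -
    have "{..n} - {m} = {..<m} \<union> {m<..n}" using assms by auto
    then have "poly q 0 = (\<Prod>j\<in>{..<m} \<union> {m<..n}. of_nat m - of_nat j)"
      by (simp only: q_def poly_prod) simp
    also have "\<dots> = (\<Prod>j<m. of_nat m - of_nat j) * (\<Prod>j\<in>{m<..n}. of_nat m - of_nat j)"
      by (rule prod.union_disjoint) auto
    also have "(\<Prod>j\<in>{m<..n}. of_nat m - of_nat j) =
        (-1) ^ (n - m) * (\<Prod>j\<in>{m<..n}. of_nat j - of_nat m :: rat)"
      using prod_uminus[of "\<lambda>j. of_nat j - of_nat m :: rat" "{m<..n}"] by simp
    finally show ?thesis by (simp add: power_add[symmetric] mult.left_commute)
  qed
  moreover have "0 \<le> (\<Prod>j<m. of_nat m - of_nat j :: rat) * (\<Prod>j\<in>{m<..n}. of_nat j - of_nat m)"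
    by (intro mult_nonneg_nonneg prod_nonneg) auto
  ultimately have "0 \<le> inverse (fact (Suc n)) * ((-1) ^ (n - m) * poly q 0)"
    by simp
  with interp lin show ?thesis by (auto simp only: mult.left_commute)
qed

text \<open>A nonempty set has no map into \<open>{1..0}\<close>, so both factors are divisible by \<open>t\<close>.\<close>

lemma interpolates_product:
  assumes "P \<inter> {..k} \<noteq> {}" "P \<inter> {k<..} \<noteq> {}"
    and free: "k \<in> P \<Longrightarrow> Suc k \<in> P \<Longrightarrow> \<rho> k = Free"
    and "interpolates p (\<lambda>t. card (path_maps \<rho> (P \<inter> {..k}) t))"
    and "interpolates q (\<lambda>t. card (path_maps \<rho> (P \<inter> {k<..}) t))"
  shows "interpolates (p * q) (\<lambda>t. card (path_maps \<rho> P t)) \<and> coeff (p * q) 1 = 0"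
proof -
  have "path_maps \<rho> Q 0 = {}" if "Q \<noteq> {}" for Q
    using that by (auto simp: path_maps_def PiE_iff)
  then have "poly p 0 = 0" "poly q 0 = 0"
    using assms(4,5)[unfolded interpolates_def, THEN spec[of _ 0]] assms(1,2) by simp_all
  then have "coeff (p * q) 1 = 0"
    by (simp add: coeff_mult poly_0_coeff_0)
  moreover have "interpolates (p * q) (\<lambda>t. card (path_maps \<rho> P t))"
    using assms(4,5) by (simp add: interpolates_def card_path_maps_split[of k P \<rho>, OF free])
  ultimately show ?thesis by blast
qed

text \<open>
  The number of \<open>Strict_Up\<close> links fixes the sign. For the induction, resolving a
  \<open>Weak_Down\<close> link lowers the number of such links, and splitting lowers the number of points.
\<close>

lemma linear_coeff_path:
  assumes "finite P"
  shows "\<exists>p. interpolates p (\<lambda>t. card (path_maps \<rho> P t)) \<and>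
    0 \<le> (-1) ^ card (links \<rho> Strict_Up P) * coeff p 1"
  using assms
proof (induction "card P + card (links \<rho> Weak_Down P)" arbitrary: P \<rho> rule: less_induct)
  case less
  have part: "\<exists>p. interpolates p (\<lambda>t. card (path_maps \<rho>' Q t))"
    if "Q \<subset> P" "links \<rho>' Weak_Down Q \<subseteq> links \<rho> Weak_Down P" for Q \<rho>'
  proof -
    have "card Q < card P" "card (links \<rho>' Weak_Down Q) \<le> card (links \<rho> Weak_Down P)"
      using psubset_card_mono[OF less.prems that(1)] card_mono[OF finite_links that(2)] less.prems
      by simp_all
    moreover have "finite Q"
      using that(1) less.prems by (meson finite_subset psubset_imp_subset)
    ultimately show ?thesis
      using less.hyps[of Q \<rho>'] by (meson add_less_le_mono)
  qed
  \<comment> \<open>The kinds \<open>\<rho>'\<close> may differ from \<open>\<rho>\<close>, because a link just made \<open>Free\<close> must be cut too.\<close>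
  have split_zero: "\<exists>p. interpolates p (\<lambda>t. card (path_maps \<rho>' P t)) \<and> coeff p 1 = 0"
    if sides: "P \<inter> {..k} \<noteq> {}" "P \<inter> {k<..} \<noteq> {}"
      and free: "k \<in> P \<Longrightarrow> Suc k \<in> P \<Longrightarrow> \<rho>' k = Free"
      and sub: "links \<rho>' Weak_Down P \<subseteq> links \<rho> Weak_Down P" for k \<rho>'
  proof -
    obtain x y where "x \<in> P" "x \<le> k" "y \<in> P" "k < y"
      using sides by auto
    then have "y \<notin> P \<inter> {..k}" "x \<notin> P \<inter> {k<..}"
      by simp_all
    with \<open>x \<in> P\<close> \<open>y \<in> P\<close> have "P \<inter> {..k} \<subset> P" "P \<inter> {k<..} \<subset> P"
      by blast+
    moreover have "links \<rho>' Weak_Down (P \<inter> A) \<subseteq> links \<rho> Weak_Down P" for A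
      using sub by (auto simp: links_def)
    ultimately obtain p q where
      "interpolates p (\<lambda>t. card (path_maps \<rho>' (P \<inter> {..k}) t))"
      "interpolates q (\<lambda>t. card (path_maps \<rho>' (P \<inter> {k<..}) t))"
      using part[of "P \<inter> {..k}" \<rho>'] part[of "P \<inter> {k<..}" \<rho>'] by metis
    then show ?thesis
      using interpolates_product[of P k \<rho>', OF sides free] by blast
  qed
  consider (empty) "P = {}"
    | (split) k where "P \<inter> {..k} \<noteq> {}" "P \<inter> {k<..} \<noteq> {}"
        "k \<in> P \<Longrightarrow> Suc k \<in> P \<Longrightarrow> \<rho> k = Free"
    | (down) k where "k \<in> P" "Suc k \<in> P" "\<rho> k = Weak_Down"
    | (up) "P \<noteq> {}" "\<And>k. P \<inter> {..k} \<noteq> {} \<Longrightarrow> P \<inter> {k<..} \<noteq> {} \<Longrightarrow>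
          k \<in> P \<and> Suc k \<in> P \<and> \<rho> k \<noteq> Free"
        "\<And>k. k \<in> P \<Longrightarrow> Suc k \<in> P \<Longrightarrow> \<rho> k \<noteq> Weak_Down"
    by blast
  then show ?case
  proof cases
    case empty
    have "path_maps \<rho> {} t = {\<lambda>x. undefined}" for t by (auto simp: path_maps_def)
    then have "interpolates 1 (\<lambda>t. card (path_maps \<rho> P t)) \<and>
        0 \<le> (-1) ^ card (links \<rho> Strict_Up P) * coeff (1 :: rat poly) 1"
      using empty by (simp add: interpolates_def)
    then show ?thesis by blast
  next
    case (split k)
    then obtain p where "interpolates p (\<lambda>t. card (path_maps \<rho> P t))" "coeff p 1 = 0"
      using split_zero[of k \<rho>] by blast
    then show ?thesis by (intro exI[of _ p]) simp
  next
    case (down k)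
    have "links (\<rho>(k := Strict_Up)) Weak_Down P \<subset> links \<rho> Weak_Down P"
      using down by (auto simp: links_def split: if_splits)
    then have "card (links (\<rho>(k := Strict_Up)) Weak_Down P) < card (links \<rho> Weak_Down P)"
      using less.prems by (intro psubset_card_mono finite_links)
    then obtain q where q: "interpolates q (\<lambda>t. card (path_maps (\<rho>(k := Strict_Up)) P t))"
      "0 \<le> (-1) ^ card (links (\<rho>(k := Strict_Up)) Strict_Up P) * coeff q 1"
      using less.hyps[of P "\<rho>(k := Strict_Up)"] less.prems by (meson add_less_cancel_left)
    have "links (\<rho>(k := Strict_Up)) Strict_Up P = insert k (links \<rho> Strict_Up P)"
      "k \<notin> links \<rho> Strict_Up P"
      using down by (auto simp: links_def split: if_splits)
    then have sign: "0 \<le> - ((-1) ^ card (links \<rho> Strict_Up P) * coeff q 1)"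
      using q(2) less.prems by (simp add: finite_links)
    have "links (\<rho>(k := Free)) Weak_Down P \<subseteq> links \<rho> Weak_Down P"
      by (auto simp: links_def split: if_splits)
    moreover have "k \<in> P \<inter> {..k}" "Suc k \<in> P \<inter> {k<..}"
      using down by auto
    ultimately obtain p where p: "interpolates p (\<lambda>t. card (path_maps (\<rho>(k := Free)) P t))"
      "coeff p 1 = 0"
      using split_zero[of k "\<rho>(k := Free)"] by auto
    have "interpolates (p - q) (\<lambda>t. card (path_maps \<rho> P t))"
      using p(1) q(1) card_path_maps_weak_down[of P k \<rho>, OF less.prems down]
      by (simp add: interpolates_def)
    moreover have "0 \<le> (-1) ^ card (links \<rho> Strict_Up P) * coeff (p - q) 1"
      using sign p(2) by simp
    ultimately show ?thesis by blast
  next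
    case up
    \<comment> \<open>As no cut is possible, \<open>P\<close> has no gaps: it is one rising chain.\<close>
    define a b where "a = Min P" and "b = Max P"
    have ab: "a \<in> P" "b \<in> P" and P_sub: "P \<subseteq> {a..b}"
      using less.prems up(1) by (auto simp: a_def b_def)
    have inner: "x \<in> P \<and> Suc x \<in> P \<and> \<rho> x \<in> {Weak_Up, Strict_Up}" if "a \<le> x" "x < b" for x
    proof -
      have "P \<inter> {..x} \<noteq> {}" "P \<inter> {x<..} \<noteq> {}" using ab that by auto
      then show ?thesis using up(2,3)[of x] by (cases "\<rho> x") auto
    qed
    have P: "P = {a..a + (b - a)}"
      using P_sub inner ab by (fastforce simp: le_less)
    let ?m = "card (links \<rho> Weak_Up P)"
    have "links \<rho> Weak_Up P \<union> links \<rho> Strict_Up P = {a..<b}"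
      using inner P_sub by (fastforce simp: links_def)
    moreover have "links \<rho> Weak_Up P \<inter> links \<rho> Strict_Up P = {}"
      by (auto simp: links_def)
    ultimately have "?m + card (links \<rho> Strict_Up P) = b - a"
      using less.prems by (metis card_Un_disjoint card_atLeastLessThan finite_links)
    then have m: "?m \<le> b - a" "card (links \<rho> Strict_Up P) = b - a - ?m" by auto
    have "card (path_maps \<rho> P t) = (t + ?m) choose Suc (b - a)" for t
      using card_path_maps_up[of a "b - a" \<rho> t] inner P by simp
    then show ?thesis
      using interpolates_binomial[OF m(1)] m(2) by simp
  qed
qed

section \<open>Ribbons are paths\<close>

text \<open>
  Two columns common to the rows \<open>i\<close> and \<open>i + 1\<close> would give a square of four boxes. Lower rows
  end no further to the right than row \<open>i + 1\<close>.
\<close>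

lemma ribbon_rows_overlap:
  assumes "ribbon la mu" "1 \<le> i" "i < k" "k \<le> length la"
  shows "la ! (k - 1) \<le> mu ! (i - 1) + 1"
proof (rule ccontr)
  assume "\<not> ?thesis"
  then have long: "mu ! (i - 1) + 2 \<le> la ! (k - 1)" by simp
  have dec: "la ! y \<le> la ! x" "mu ! y \<le> mu ! x" if "x \<le> y" "y < length la" for x y
    using assms(1) that
    by (cases "x = y"; auto simp: ribbon_def skew_shape_def sorted_wrt_iff_nth_less)+
  let ?j = "mu ! (i - 1) + 1"
  have "mu ! i \<le> mu ! (i - 1)" "la ! i \<le> la ! (i - 1)" "la ! (k - 1) \<le> la ! i"
    using dec[of "i - 1" i] dec[of i "k - 1"] assms by auto
  with long have "{(i, ?j), (i + 1, ?j), (i, ?j + 1), (i + 1, ?j + 1)} \<subseteq> boxes la mu"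
    using assms by (auto simp: boxes_def)
  then show False
    using assms(1) unfolding ribbon_def by blast
qed

text \<open>
  The content \<open>j - i\<close> of a box, shifted by the number of rows to stay within the natural
  numbers.
\<close>

definition box_content :: "nat list \<Rightarrow> nat \<times> nat \<Rightarrow> nat" where
  "box_content la = (\<lambda>(i, j). j + (length la - i))"

context
  fixes la mu :: "nat list"
  assumes rib: "ribbon la mu"
begin

lemma overlap_boxes:
  assumes "(i, j) \<in> boxes la mu" "(k, m) \<in> boxes la mu" "i < k"
  shows "m \<le> j"
  using assms ribbon_rows_overlap[OF rib, of i k] by (auto simp: boxes_def)

text \<open>
  Going down in a ribbon means not going right, so the content cannot stay the same in another row.
\<close>

lemma box_content_inj: "inj_on (box_content la) (boxes la mu)"
proof (rule inj_onI, clarify)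
  fix i j k m
  assume b: "(i, j) \<in> boxes la mu" "(k, m) \<in> boxes la mu" and eq: "box_content la (i, j) = box_content la (k, m)"
  have "i \<le> length la" "k \<le> length la" using b by (auto simp: boxes_def)
  then show "i = k \<and> j = m"
    using overlap_boxes[OF b] overlap_boxes[OF b(2) b(1)] eq
    by (cases i k rule: linorder_cases) (auto simp: box_content_def)
qed

lemma box_content_Suc:
  assumes "(i, j) \<in> boxes la mu" "(k, m) \<in> boxes la mu"
    and "box_content la (k, m) = Suc (box_content la (i, j))"
  shows "(k = i \<and> m = j + 1) \<or> (i = k + 1 \<and> m = j)"
proof -
  have le: "i \<le> length la" "k \<le> length la" using assms by (auto simp: boxes_def)
  show ?thesis
    using overlap_boxes[OF assms(1,2)] overlap_boxes[OF assms(2,1)] assms(3) le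
    by (cases i k rule: linorder_cases) (auto simp: box_content_def)
qed

end

text \<open>The first component of a pair is the lower one, as in \<open>box_step\<close>.\<close>

definition path_rel :: "nat set \<Rightarrow> nat rel" where
  "path_rel U = {(i, Suc i) | i. i \<in> U} \<union> {(Suc i, i) | i. i \<notin> U}"

text \<open>
  The set \<open>U\<close> collects the contents of the boxes that have a box above them. Such a box has none to its
  right, since the two neighbours would have the same content; so \<open>U\<close> tells vertical steps from
  horizontal ones.
\<close>

lemma ribbon_path:
  assumes rib: "ribbon la mu"
  shows "\<exists>U. \<forall>a\<in>boxes la mu. \<forall>b\<in>boxes la mu.
    (a, b) \<in> box_step la mu \<longleftrightarrow> (box_content la a, box_content la b) \<in> path_rel U"
proof -
  let ?B = "boxes la mu"
  define U where "U = {box_content la (i + 1, j) | i j. (i, j) \<in> ?B \<and> (i + 1, j) \<in> ?B}"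
  note inj = inj_onD[OF box_content_inj[OF rib]]
  have vert: "box_content la (i, j) = Suc (box_content la (i + 1, j))" if "(i + 1, j) \<in> ?B" for i j
    using that by (auto simp: boxes_def box_content_def)
  have horiz: "box_content la (i, j + 1) = Suc (box_content la (i, j))" for i j
    by (simp add: box_content_def)
  have not_U: "box_content la (i, j) \<notin> U" if "(i, j) \<in> ?B" "(i, j + 1) \<in> ?B" for i j
  proof
    assume "box_content la (i, j) \<in> U"
    then obtain k m where km: "box_content la (i, j) = box_content la (k + 1, m)"
      "(k, m) \<in> ?B" "(k + 1, m) \<in> ?B" by (auto simp: U_def)
    have "box_content la (k, m) = box_content la (i, j + 1)"
      using km vert horiz by simp
    then have "(k, m) = (i, j + 1)"
      using inj km that by blast
    moreover have "(i, j) = (k + 1, m)"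
      using inj km that by blast
    ultimately show False by simp
  qed
  have "(a, b) \<in> box_step la mu \<longleftrightarrow> (box_content la a, box_content la b) \<in> path_rel U"
    if a: "a \<in> ?B" and b: "b \<in> ?B" for a b
  proof
    assume "(a, b) \<in> box_step la mu"
    then consider i j where "a = (i + 1, j)" "b = (i, j)"
      | i j where "a = (i, j + 1)" "b = (i, j)"
      by (auto simp: box_step_def)
    then show "(box_content la a, box_content la b) \<in> path_rel U"
    proof cases
      case 1
      then have "box_content la a \<in> U" using a b by (auto simp: U_def)
      then show ?thesis using vert a 1 by (auto simp: path_rel_def)
    next
      case 2
      then show ?thesis using not_U horiz a b by (auto simp: path_rel_def)
    qed
  next
    assume "(box_content la a, box_content la b) \<in> path_rel U"
    then consider "box_content la a \<in> U" "box_content la b = Suc (box_content la a)"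
      | "box_content la b \<notin> U" "box_content la a = Suc (box_content la b)"
      by (auto simp: path_rel_def)
    then show "(a, b) \<in> box_step la mu"
    proof cases
      case 1
      then obtain i j where ij: "box_content la a = box_content la (i + 1, j)"
        "(i, j) \<in> ?B" "(i + 1, j) \<in> ?B" by (auto simp: U_def)
      have "a = (i + 1, j)" "b = (i, j)"
        using inj ij a b 1 vert by metis+
      then show ?thesis using ij by (auto simp: box_step_def)
    next
      case 2
      obtain i j k m where ab: "b = (i, j)" "a = (k, m)" by (cases a, cases b) auto
      from box_content_Suc[OF rib, of i j k m] 2 a b ab
      consider "k = i" "m = j + 1" | "i = k + 1" "m = j" by auto
      then show ?thesis
      proof cases
        case 1
        then show ?thesis using a b ab by (auto simp: box_step_def)
      next
        case 2
        then have "box_content la b \<in> U" using a b ab by (auto simp: U_def)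
        with \<open>box_content la b \<notin> U\<close> show ?thesis by simp
      qed
    qed
  qed
  then show ?thesis by blast
qed

lemma order_preserving_maps_cell_order:
  "order_preserving_maps (boxes la mu) (cell_order la mu) t =
   order_preserving_maps (boxes la mu) (box_step la mu) t"
proof -
  let ?B = "boxes la mu"
  have "f x \<le> f y"
    if f: "\<forall>x\<in>?B. \<forall>y\<in>?B. (x, y) \<in> box_step la mu \<longrightarrow> f x \<le> f y"
      and "(x, y) \<in> (box_step la mu)\<^sup>*" for f :: "nat \<times> nat \<Rightarrow> nat" and x y
    using that(2)
  proof induction
    case (step y z)
    have "y \<in> ?B" "z \<in> ?B" using step.hyps(2) by (auto simp: box_step_def)
    then show ?case using f step by (meson order_trans)
  qed simp
  then show ?thesis
    unfolding order_preserving_maps_def monotone_on_def cell_order_def by blast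
qed

lemma card_order_preserving_maps_iso:
  assumes "bij_betw g P Q" "\<And>x y. x \<in> P \<Longrightarrow> y \<in> P \<Longrightarrow> (x, y) \<in> r \<longleftrightarrow> (g x, g y) \<in> s"
  shows "card (order_preserving_maps P r t) = card (order_preserving_maps Q s t)"
proof -
  let ?F = "\<lambda>h. restrict (h \<circ> g) P" and ?G = "\<lambda>f. restrict (f \<circ> inv_into P g) Q"
  have g: "g x \<in> Q" "inv_into P g (g x) = x" if "x \<in> P" for x
    using assms(1) that by (auto simp: bij_betw_def)
  have g': "inv_into P g y \<in> P" "g (inv_into P g y) = y" if "y \<in> Q" for y
    using assms(1) that by (auto simp: bij_betw_def inv_into_into f_inv_into_f)
  have "bij_betw ?F (order_preserving_maps Q s t) (order_preserving_maps P r t)"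
  proof (rule bij_betw_byWitness[where f' = ?G])
    show "\<forall>h\<in>order_preserving_maps Q s t. ?G (?F h) = h"
      "\<forall>f\<in>order_preserving_maps P r t. ?F (?G f) = f"
      using g g' by (auto simp: order_preserving_maps_def PiE_iff extensional_def fun_eq_iff)
    show "?F ` order_preserving_maps Q s t \<subseteq> order_preserving_maps P r t"
      using g assms(2) by (auto simp: order_preserving_maps_def PiE_iff monotone_on_def)
    show "?G ` order_preserving_maps P r t \<subseteq> order_preserving_maps Q s t"
      using g' assms(2) by (auto simp: order_preserving_maps_def PiE_iff monotone_on_def)
  qed
  then show ?thesis by (simp add: bij_betw_same_card)
qed

lemma finite_boxes: "finite (boxes la mu)"
proof (rule finite_subset)
  show "boxes la mu \<subseteq> (\<Union>i\<in>{1..length la}. Pair i ` {..la ! (i - 1)})"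
    by (force simp: boxes_def)
qed auto

section \<open>Fences\<close>

lemma order_preserving_maps_path_rel:
  "order_preserving_maps Q (path_rel U) t =
     path_maps (\<lambda>i. if i \<in> U then Weak_Up else Weak_Down) Q t"
proof -
  have "(\<forall>x\<in>Q. \<forall>y\<in>Q. (x, y) \<in> path_rel U \<longrightarrow> f x \<le> f y) \<longleftrightarrow>
      (\<forall>i. i \<in> Q \<and> Suc i \<in> Q \<longrightarrow> fits (if i \<in> U then Weak_Up else Weak_Down) (f i) (f (Suc i)))"
    (is "?mono \<longleftrightarrow> ?fits") for f :: "nat \<Rightarrow> nat"
  proof
    assume mono: ?mono
    show ?fits
    proof (intro allI impI)
      fix i assume "i \<in> Q \<and> Suc i \<in> Q"
      then show "fits (if i \<in> U then Weak_Up else Weak_Down) (f i) (f (Suc i))"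
        using mono[rule_format, of i "Suc i"] mono[rule_format, of "Suc i" i]
        by (cases "i \<in> U") (simp_all add: path_rel_def)
    qed
  next
    assume fits: ?fits
    have "f x \<le> f y" if "x \<in> Q" "y \<in> Q" "(x, y) \<in> path_rel U" for x y
    proof -
      consider "x \<in> U" "y = Suc x" | "y \<notin> U" "x = Suc y"
        using \<open>(x, y) \<in> path_rel U\<close> by (auto simp: path_rel_def)
      then show ?thesis
        using fits[rule_format, of x] fits[rule_format, of y] \<open>x \<in> Q\<close> \<open>y \<in> Q\<close> by cases simp_all
    qed
    then show ?mono by blast
  qed
  then show ?thesis
    unfolding order_preserving_maps_def monotone_on_def path_maps_def by simp
qed

lemma nonneg_coeffs_path:
  assumes "finite Q"
  shows "\<exists>p. interpolates p (\<lambda>t. card (order_preserving_maps Q (path_rel U) t)) \<and>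
    (\<forall>n. 0 \<le> coeff p n)"
proof -
  let ?\<rho> = "\<lambda>i. if i \<in> U then Weak_Up else Weak_Down"
  have "links ?\<rho> Strict_Up R = {}" for R
    by (auto simp: links_def)
  then have "\<exists>p. interpolates p (\<lambda>t. card (order_preserving_maps R (path_rel U) t)) \<and> 0 \<le> coeff p 1"
    if "R \<subseteq> Q" for R
    using linear_coeff_path[of R ?\<rho>] finite_subset[OF that assms]
    by (simp add: order_preserving_maps_path_rel)
  then obtain W where
    "\<And>R. R \<subseteq> Q \<Longrightarrow> interpolates (W R) (\<lambda>t. card (order_preserving_maps R (path_rel U) t))"
    "\<And>R. R \<subseteq> Q \<Longrightarrow> 0 \<le> coeff (W R) 1"
    by metis
  then show ?thesis
    using nonneg_coeffs_if_linear_coeffs_nonneg[OF assms, of W "path_rel U"] by blast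
qed

theorem corollary1p2:
  fixes P :: "'a set" and r :: "'a rel"
  assumes "fence_poset P r"
  shows "\<forall>n. coeff (order_polynomial P r) n \<ge> 0"
proof -
  obtain la mu where rib: "ribbon la mu"
    and iso: "poset_isomorphic P r (boxes la mu) (cell_order la mu)"
    using assms by (auto simp: fence_poset_def)
  let ?B = "boxes la mu"
  obtain g where g: "bij_betw g P ?B"
    "\<And>x y. x \<in> P \<Longrightarrow> y \<in> P \<Longrightarrow> (x, y) \<in> r \<longleftrightarrow> (g x, g y) \<in> cell_order la mu"
    using iso unfolding poset_isomorphic_def by blast
  obtain U where U: "\<And>a b. a \<in> ?B \<Longrightarrow> b \<in> ?B \<Longrightarrow>
      (a, b) \<in> box_step la mu \<longleftrightarrow> (box_content la a, box_content la b) \<in> path_rel U"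
    using ribbon_path[OF rib] by blast
  have "bij_betw (box_content la) ?B (box_content la ` ?B)"
    using box_content_inj[OF rib] by (rule inj_on_imp_bij_betw)
  then have "card (order_preserving_maps P r t) =
      card (order_preserving_maps (box_content la ` ?B) (path_rel U) t)" for t
    using card_order_preserving_maps_iso[OF g] card_order_preserving_maps_iso[OF _ U]
    by (simp add: order_preserving_maps_cell_order)
  moreover obtain p where
    "interpolates p (\<lambda>t. card (order_preserving_maps (box_content la ` ?B) (path_rel U) t))"
    "\<forall>n. 0 \<le> coeff p n"
    using nonneg_coeffs_path[of "box_content la ` ?B" U] finite_boxes by blast
  ultimately show ?thesis
    using order_polynomial_eqI[of p P r] by simp
qed

end
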